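(* Let $\Omega\subset\mathbb{R}^n$ be a domain with the following property: for any $z\in\partial\Omega$ and any $s>0$ small, there exist $\nu\in C(\overline{\Omega}\cap B_s(z);\mathbb{R}^n)$ and $c>0$ small such that $B_{c\tau}(y+\tau\nu(y))\subset\Omega$ for all $y\in\overline{\Omega}\cap B_s(z)$ and $0<\tau\le c$. Let $F\in C(\Omega\times\mathbb{R}^n\times\mathbb{S}^n)$ satisfy $F(x,p,X)\le F(x,p,Y)$ for all $x\in\Omega$, $p\in\mathbb{R}^n$ and $X,Y\in\mathbb{S}^n$ with $X\ge Y$. Consider the equation $$u+F(x,\nabla u,\nabla^2u)=0\quad\text{in }\Omega.\qquad( * )$$ Let $x_0\in\partial\Omega$. 1) Assume that for any modulus of continuity $\omega$, $$\lim_{\delta\to0+}\inf\{F(x,p,X):\ x\in\Omega,\ |x-x_0|\le\delta,\ |p|\le\omega(\delta)/\delta,\ |X|\le\omega(\delta)/\delta^2\}\ge0.$$ If $u\in USC(\Omega)$ is a bounded viscosity subsolution of $( * )$ and $u^\ast$ is continuous at $x_0$, then $u^\ast(x_0)\le0$. 2) Assume that for any modulus of continuity $\omega$, $$\lim_{\delta\to0+}\sup\{F(x,p,X):\ x\in\Omega,\ |x-x_0|\le\delta,\ |p|\le\omega(\delta)/\delta,\ |X|\le\omega(\delta)/\delta^2\}\le0.$$ If $u\in LSC(\Omega)$ is a bounded viscosity supersolution of $( * )$ and $u_\ast$ is continuous at $x_0$, then $u_\ast(x_0)\ge0$. In particular, if for any modulus of continuity $\omega$ $$\sup\{|F(x,p,X)|:\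 x\in\Omega,\ d(x)\le\delta,\ |p|\le\omega(\delta)/\delta,\ |X|\le\omega(\delta)/\delta^2\}\to0\quad\text{as }\delta\to0,$$ then any viscosity solution $u\in C(\Omega)$ of $( * )$ that is continuous at $x_0\in\partial\Omega$ (i.e. extends continuously to $\Omega\cup\{x_0\}$) satisfies $u(x_0)=0$.
   Context: $\mathbb{S}^n$ is the set of all real symmetric $n\times n$ matrices with the usual partial order; $B_r(x)$ is the open ball centered at $x$ with radius $r$; $d(x)$ denotes the distance from $x\in\overline{\Omega}$ to $\partial\Omega$. $USC(S)$ and $LSC(S)$ are the classes of upper and lower semicontinuous functions in $S$. A modulus of continuity is a nonnegative increasing function $\omega\in C([0,\infty))$ with $\omega(0)=0$. For a bounded function $u$ in $\Omega$, $u^\ast$ and $u_\ast$ are its semicontinuous envelopes on $\overline{\Omega}$: for $x\in\overline{\Omega}$, $u^\ast(x)=\lim_{\delta\to0}\sup\{u(y):y\in\Omega,|y-x|\le\delta\}$ and $u_\ast(x)=\lim_{\delta\to0}\inf\{u(y):y\in\Omega,|y-x|\le\delta\}$. Continuity of $u^\ast$ or $u_\ast$ at $x_0$ is as a function on $\overline{\Omega}$. Viscosity solutions. A locally bounded $u\in USC(\Omega)$ (resp. $LSC(\Omega)$) is a viscosity subsolution (resp. supersolution) of $( * )$ if whenever $z\in\Omega$ and $\varphi\in C^2(\Omega)$ are such that $u-\varphi$ attains a local maximum (resp. minimum) at $z$, one has $u(z)+F(z,\nabla\varphi(z),\nabla^2\varphi(z))\le0$ (resp. $\ge0$). A function $u\in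 C(\Omega)$ is a viscosity solution if it is both a viscosity subsolution and a viscosity supersolution. *)

theory Defs
  imports "HOL-Analysis.Analysis"
begin

definition sym_matrices :: "(real^'n^'n) set" where
  "sym_matrices = {X. transpose X = X}"

(* The usual (Loewner) order; the library order on "real^'n^'n" is componentwise and is not
   the one meant here. *)
definition loewner_le :: "real^'n^'n \<Rightarrow> real^'n^'n \<Rightarrow> bool" where
  "loewner_le X Y \<longleftrightarrow> (\<forall>\<xi>. \<xi> \<bullet> (X *v \<xi>) \<le> \<xi> \<bullet> (Y *v \<xi>))"

definition modulus_of_continuity :: "(real \<Rightarrow> real) \<Rightarrow> bool" where
  "modulus_of_continuity \<omega> \<longleftrightarrow>
     continuous_on {0..} \<omega> \<and> mono_on {0..} \<omega> \<and> (\<forall>t\<ge>0. 0 \<le> \<omega> t) \<and> \<omega> 0 = 0"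

definition usc_on :: "'a::topological_space set \<Rightarrow> ('a \<Rightarrow> real) \<Rightarrow> bool" where
  "usc_on S u \<longleftrightarrow> (\<forall>x\<in>S. \<forall>a>u x. \<forall>\<^sub>F y in at x within S. u y < a)"

definition lsc_on :: "'a::topological_space set \<Rightarrow> ('a \<Rightarrow> real) \<Rightarrow> bool" where
  "lsc_on S u \<longleftrightarrow> (\<forall>x\<in>S. \<forall>a<u x. \<forall>\<^sub>F y in at x within S. a < u y)"

(* Semicontinuous envelopes; meaningful for u bounded on \<Omega> and x in the closure of \<Omega>, where
   the sup/inf are over nonempty bounded sets and monotone in \<delta>, so that the limit exists. *)
definition upper_envelope :: "'a::metric_space set \<Rightarrow> ('a \<Rightarrow> real) \<Rightarrow> 'a \<Rightarrow> real" where
  "upper_envelope \<Omega> u x = Lim (at_right 0) (\<lambda>\<delta>. SUP y\<in>{y\<in>\<Omega>. dist y x \<le> \<delta>}. u y)"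

definition lower_envelope :: "'a::metric_space set \<Rightarrow> ('a \<Rightarrow> real) \<Rightarrow> 'a \<Rightarrow> real" where
  "lower_envelope \<Omega> u x = Lim (at_right 0) (\<lambda>\<delta>. INF y\<in>{y\<in>\<Omega>. dist y x \<le> \<delta>}. u y)"

definition locally_bounded_on :: "'a::metric_space set \<Rightarrow> ('a \<Rightarrow> real) \<Rightarrow> bool" where
  "locally_bounded_on S u \<longleftrightarrow> (\<forall>x\<in>S. \<exists>r>0. bounded (u ` (S \<inter> ball x r)))"

(* \<phi> is twice continuously differentiable on the open set \<Omega>, with gradient g and Hessian H. *)
definition C2_on_with ::
  "(real^'n) set \<Rightarrow> (real^'n \<Rightarrow> real) \<Rightarrow> (real^'n \<Rightarrow> real^'n) \<Rightarrow> (real^'n \<Rightarrow> real^'n^'n) \<Rightarrow> bool" where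
  "C2_on_with \<Omega> \<phi> g H \<longleftrightarrow>
     (\<forall>x\<in>\<Omega>. GDERIV \<phi> x :> g x) \<and>
     (\<forall>x\<in>\<Omega>. (g has_derivative (\<lambda>h. H x *v h)) (at x)) \<and>
     continuous_on \<Omega> H"

(* Viscosity sub-/super-/solutions of u + F(x, Du, D^2 u) = 0 in the open set \<Omega>. *)

definition viscosity_subsolution ::
  "(real^'n) set \<Rightarrow> ((real^'n) \<times> (real^'n) \<times> (real^'n^'n) \<Rightarrow> real) \<Rightarrow> (real^'n \<Rightarrow> real) \<Rightarrow> bool" where
  "viscosity_subsolution \<Omega> F u \<longleftrightarrow>
     locally_bounded_on \<Omega> u \<and> usc_on \<Omega> u \<and>
     (\<forall>z\<in>\<Omega>. \<forall>\<phi> g H. C2_on_with \<Omega> \<phi> g H \<longrightarrow>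
        (\<forall>\<^sub>F y in at z within \<Omega>. u y - \<phi> y \<le> u z - \<phi> z) \<longrightarrow>
        u z + F (z, g z, H z) \<le> 0)"

definition viscosity_supersolution ::
  "(real^'n) set \<Rightarrow> ((real^'n) \<times> (real^'n) \<times> (real^'n^'n) \<Rightarrow> real) \<Rightarrow> (real^'n \<Rightarrow> real) \<Rightarrow> bool" where
  "viscosity_supersolution \<Omega> F u \<longleftrightarrow>
     locally_bounded_on \<Omega> u \<and> lsc_on \<Omega> u \<and>
     (\<forall>z\<in>\<Omega>. \<forall>\<phi> g H. C2_on_with \<Omega> \<phi> g H \<longrightarrow>
        (\<forall>\<^sub>F y in at z within \<Omega>. u z - \<phi> z \<le> u y - \<phi> y) \<longrightarrow>
        0 \<le> u z + F (z, g z, H z))"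

definition viscosity_solution ::
  "(real^'n) set \<Rightarrow> ((real^'n) \<times> (real^'n) \<times> (real^'n^'n) \<Rightarrow> real) \<Rightarrow> (real^'n \<Rightarrow> real) \<Rightarrow> bool" where
  "viscosity_solution \<Omega> F u \<longleftrightarrow>
     continuous_on \<Omega> u \<and> viscosity_subsolution \<Omega> F u \<and> viscosity_supersolution \<Omega> F u"

definition interior_cone_property :: "(real^'n) set \<Rightarrow> bool" where
  "interior_cone_property \<Omega> \<longleftrightarrow>
     (\<forall>z\<in>frontier \<Omega>. \<exists>s\<^sub>0>0. \<forall>s. 0 < s \<and> s < s\<^sub>0 \<longrightarrow>
        (\<exists>\<nu> c. continuous_on (closure \<Omega> \<inter> ball z s) \<nu> \<and> c > 0 \<and>
           (\<forall>y\<in>closure \<Omega> \<inter> ball z s. \<forall>\<tau>. 0 < \<tau> \<and> \<tau> \<le> c \<longrightarrow>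
              ball (y + \<tau> *\<^sub>R \<nu> y) (c * \<tau>) \<subseteq> \<Omega>)))"

(* The matrix norm is the library (Frobenius) norm. Suprema and infima over these sets are only
   considered for all moduli of continuity \<omega> at once, so constant factors are immaterial. *)
definition jet_set ::
  "(real^'n) set \<Rightarrow> (real \<Rightarrow> real) \<Rightarrow> real \<Rightarrow> ((real^'n) \<times> (real^'n) \<times> (real^'n^'n)) set" where
  "jet_set A \<omega> \<delta> =
     {(x, p, X). x \<in> A \<and> norm p \<le> \<omega> \<delta> / \<delta> \<and> X \<in> sym_matrices \<and> norm X \<le> \<omega> \<delta> / \<delta>\<^sup>2}"

end

theory Submission
  imports Defs
begin

text \<open>The limit \<open>M\<close> of \<open>u\<close> at \<open>x\<^sub>0\<close> exists, and \<open>\<bar>u - M\<bar> \<le> \<omega>(\<bar>x - x\<^sub>0\<bar>)\<close> for a modulus \<open>\<omega>\<close>. The interior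
  condition at \<open>x\<^sub>0\<close> provides balls in \<open>\<Omega>\<close> whose radius and whose distance to \<open>x\<^sub>0\<close> are both comparable
  to \<open>\<delta>\<close>. On such a ball \<open>u\<close> oscillates by at most \<open>2\<omega>(\<delta>)\<close>, so a paraboloid centered there with opening
  of order \<open>\<omega>(\<delta>)/\<delta>\<^sup>2\<close> touches \<open>u\<close> from above at some interior point \<open>z\<close>, with gradient and
  Hessian of order \<open>\<omega>(\<delta>)/\<delta>\<close> and \<open>\<omega>(\<delta>)/\<delta>\<^sup>2\<close>. Hence \<open>M - \<omega>(\<delta>) \<le> u(z) \<le> - F(z, p, X) \<le> o(1)\<close>.
  The statement on supersolutions follows by passing to \<open>-u\<close> and \<open>-F(x, -p, -X)\<close>.\<close>

section \<open>Construction and limits of moduli of continuity\<close>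

text \<open>The supremum of \<bar>f\<bar> over balls about \<open>a\<close> is monotone but may
  jump, so each value is weighted by the continuous cutoff \<open>min 1 (t / dist y a)\<close>. The
  weight is 1 at \<open>t = dist y a\<close>, which keeps the domination;
  \<open>a \<notin> S\<close> makes the quotient meaningful.\<close>

lemma dominating_modulus_of_continuity:
  fixes f :: "'a::metric_space \<Rightarrow> real"
  assumes lim: "(f \<longlongrightarrow> 0) (at a within S)" and bdd: "bounded (f ` S)" and "a \<notin> S"
  obtains \<omega> where "modulus_of_continuity \<omega>" and "\<And>y. y \<in> S \<Longrightarrow> \<bar>f y\<bar> \<le> \<omega> (dist y a)"
proof -
  obtain B where B: "B > 0" "\<And>y. y \<in> S \<Longrightarrow> \<bar>f y\<bar> \<le> B"
    using bdd by (force simp: bounded_pos)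
  have d0: "0 < dist y a" if "y \<in> S" for y
    using that \<open>a \<notin> S\<close> by auto
  \<comment> \<open>For each \<open>y\<close>, \<open>q t y\<close> increases and \<open>q t y / t\<close> decreases in \<open>t\<close>. Both properties pass to the
    supremum over \<open>y\<close>, where together they give continuity on \<open>(0, \<infinity>)\<close>.\<close>
  define q where "q t y = \<bar>f y\<bar> * min 1 (t / dist y a)" for t y
  define \<omega> where "\<omega> t = Sup (insert 0 (q t ` S))" for t
  have qB: "q t y \<le> B" if "y \<in> S" for t y
    using mult_left_mono[of "min 1 (t / dist y a)" 1 "\<bar>f y\<bar>"] B(2)[OF that] by (simp add: q_def)
  have bddab: "bdd_above (insert 0 (q t ` S))" for t
    by (rule bdd_aboveI[of _ B]) (use qB B(1) in force)
  have q_le: "q t y \<le> \<omega> t" if "y \<in> S" for t y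
    unfolding \<omega>_def by (intro cSup_upper bddab) (use that in auto)
  have nonneg: "0 \<le> \<omega> t" for t
    unfolding \<omega>_def by (intro cSup_upper bddab) auto
  have \<omega>_le: "\<omega> t \<le> C" if "0 \<le> C" "\<And>y. y \<in> S \<Longrightarrow> q t y \<le> C" for t C
    unfolding \<omega>_def by (intro cSup_least) (use that in auto)
  have mono: "\<omega> t \<le> \<omega> s" if "t \<le> s" for t s
  proof (rule \<omega>_le[OF nonneg])
    fix y assume y: "y \<in> S"
    have "q t y \<le> q s y"
      unfolding q_def by (intro mult_left_mono min.mono divide_right_mono) (use that in auto)
    then show "q t y \<le> \<omega> s"
      using q_le[OF y, of s] by simp
  qed
  have scale: "\<omega> s \<le> s / t * \<omega> t" if "0 < t" "t \<le> s" for s t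
  proof (rule \<omega>_le)
    show "0 \<le> s / t * \<omega> t"
      using that nonneg[of t] by simp
    fix y assume y: "y \<in> S"
    have "min 1 (s / dist y a) \<le> s / t * min 1 (t / dist y a)"
      using that d0[OF y] by (auto simp: min_def field_simps)
    then have "q s y \<le> s / t * q t y"
      unfolding q_def using mult_left_mono[of _ _ "\<bar>f y\<bar>"] by (fastforce simp: mult_ac)
    also have "\<dots> \<le> s / t * \<omega> t"
      by (intro mult_left_mono q_le y) (use that in auto)
    finally show "q s y \<le> s / t * \<omega> t" .
  qed
  have zero: "\<omega> 0 = 0"
    using \<omega>_le[of 0 0] nonneg[of 0] by (auto simp: q_def)
  have "continuous (at t within {0..}) \<omega>" if "0 \<le> t" for t
  proof (cases "t = 0")
    case True
    have "(\<omega> \<longlongrightarrow> 0) (at 0 within {0..})"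
    proof (rule order_tendstoI)
      fix e :: real assume "e < 0"
      then have "e < \<omega> s" for s
        using nonneg[of s] by linarith
      then show "\<forall>\<^sub>F s in at 0 within {0..}. e < \<omega> s"
        by simp
    next
      fix e :: real assume "0 < e"
      then have "\<forall>\<^sub>F y in at a within S. \<bar>f y\<bar> < e / 2"
        using tendstoD[OF lim, of "e / 2"] by simp
      then obtain r where r: "r > 0" "\<And>y. y \<in> S \<Longrightarrow> dist y a < r \<Longrightarrow> \<bar>f y\<bar> < e / 2"
        using \<open>a \<notin> S\<close> unfolding eventually_at by metis
      \<comment> \<open>Points within \<open>r\<close> of \<open>a\<close> contribute at most
        \<open>e / 2\<close> because \<open>f\<close> is small there. Farther points carry a weight
        of at most \<open>s / r\<close>, hence contribute at most \<open>B * s / r\<close>; the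
        threshold on \<open>s\<close> makes this at most \<open>e / 2\<close> as well.\<close>
      have "\<omega> s < e" if s: "0 \<le> s" "s < r * e / (2 * B)" for s
      proof -
        have "\<omega> s \<le> e / 2"
        proof (rule \<omega>_le)
          fix y assume y: "y \<in> S"
          show "q s y \<le> e / 2"
          proof (cases "dist y a < r")
            case True
            have "q s y \<le> \<bar>f y\<bar>"
              unfolding q_def by (rule mult_left_le) auto
            then show ?thesis
              using r(2)[OF y True] by simp
          next
            case False
            have "q s y \<le> B * (s / r)"
              unfolding q_def
            proof (intro mult_mono B(2) y)
              have "s / dist y a \<le> s / r"
                using False r(1) s(1) d0[OF y] by (intro divide_left_mono) auto
              then show "min 1 (s / dist y a) \<le> s / r"
                by simp
            qed (use B(1) s(1) in auto)
            also have "\<dots> \<le> e / 2"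
              using s(2) B(1) r(1) by (simp add: field_simps)
            finally show ?thesis .
          qed
        qed (use \<open>0 < e\<close> in simp)
        then show ?thesis
          using \<open>0 < e\<close> by simp
      qed
      moreover have "0 < r * e / (2 * B)"
        using r(1) B(1) \<open>0 < e\<close> by simp
      ultimately show "\<forall>\<^sub>F s in at 0 within {0..}. \<omega> s < e"
        unfolding eventually_at by (intro exI[of _ "r * e / (2 * B)"]) (auto simp: dist_real_def)
    qed
    then show ?thesis
      using True zero by (simp add: continuous_within)
  next
    case False
    then have t: "0 < t"
      using that by simp
    have bound: "norm (\<omega> s - \<omega> t) \<le> \<bar>s / t - 1\<bar> * \<omega> t" if "0 < s" for s
    proof (cases "t \<le> s")
      case True
      have "\<omega> t \<le> \<omega> s" "\<omega> s \<le> s / t * \<omega> t" "1 \<le> s / t"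
        using mono[OF True] scale[OF t True] t True by auto
      then show ?thesis
        by (simp add: algebra_simps)
    next
      case False
      have "\<omega> s \<le> \<omega> t" "\<omega> t \<le> t / s * \<omega> s" "s / t \<le> 1"
        using mono[of s t] scale[of s t] t False that by auto
      moreover from this(2) have "s / t * \<omega> t \<le> \<omega> s"
        using t that by (simp add: field_simps)
      ultimately show ?thesis
        by (simp add: algebra_simps)
    qed
    have "((\<lambda>s. \<bar>s / t - 1\<bar> * \<omega> t) \<longlongrightarrow> \<bar>t / t - 1\<bar> * \<omega> t) (at t)"
      by (intro tendsto_intros) (use t in simp)
    then have "((\<lambda>s. \<bar>s / t - 1\<bar> * \<omega> t) \<longlongrightarrow> 0) (at t)"
      using t by simp
    moreover have "\<forall>\<^sub>F s in at t. norm (\<omega> s - \<omega> t) \<le> \<bar>s / t - 1\<bar> * \<omega> t"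
      using order_tendstoD(1)[OF tendsto_ident_at t] by (rule eventually_mono) (rule bound)
    ultimately have "((\<lambda>s. \<omega> s - \<omega> t) \<longlongrightarrow> 0) (at t)"
      by (rule Lim_null_comparison[rotated])
    then have "(\<omega> \<longlongrightarrow> \<omega> t) (at t)"
      by (simp add: LIM_zero_iff)
    then show ?thesis
      by (simp add: continuous_within tendsto_within_subset[of _ _ _ UNIV])
  qed
  then have "modulus_of_continuity \<omega>"
    unfolding modulus_of_continuity_def continuous_on_eq_continuous_within
    using mono nonneg zero by (auto simp: mono_on_def)
  moreover have "\<bar>f y\<bar> \<le> \<omega> (dist y a)" if "y \<in> S" for y
    using q_le[OF that, of "dist y a"] d0[OF that] by (simp add: q_def)
  ultimately show ?thesis
    by (rule that)
qed

lemma modulus_of_continuity_tendsto: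
  assumes "modulus_of_continuity \<omega>"
  shows "(\<omega> \<longlongrightarrow> 0) (at_right 0)"
proof -
  have "(\<omega> \<longlongrightarrow> 0) (at 0 within {0..})"
    using assms by (force simp: modulus_of_continuity_def continuous_on_def)
  then show ?thesis
    by (rule tendsto_within_subset) auto
qed

section \<open>Semicontinuity and touching by paraboloids\<close>

text \<open>Without a maximum point, the sets where \<open>h x < h y\<close>, for \<open>y\<close>
  in \<open>S\<close>, cover \<open>S\<close>; they are open because \<open>\<Omega>\<close> is open
  and \<open>h\<close> is upper semicontinuous. In a finite subcover, the point with the largest
  value is covered by none of the sets.\<close>

lemma usc_on_attains_sup:
  fixes h :: "'a::metric_space \<Rightarrow> real"
  assumes "open \<Omega>" and usc: "usc_on \<Omega> h" and "compact S" and "S \<subseteq> \<Omega>" and "S \<noteq> {}"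
  shows "\<exists>z\<in>S. \<forall>y\<in>S. h y \<le> h z"
proof -
  have op: "open {x \<in> \<Omega>. h x < a}" for a
  proof (rule openI)
    fix x assume x: "x \<in> {x \<in> \<Omega>. h x < a}"
    then have "\<forall>\<^sub>F y in at x within \<Omega>. h y < a"
      using usc by (auto simp: usc_on_def)
    then have "\<forall>\<^sub>F y in nhds x. y \<in> \<Omega> \<and> h y < a"
      using x \<open>open \<Omega>\<close> eventually_nhds_in_open[of \<Omega> x]
      by (auto simp: eventually_at_filter elim: eventually_elim2)
    then show "\<exists>e>0. ball x e \<subseteq> {x \<in> \<Omega>. h x < a}"
      unfolding eventually_nhds_metric by (force simp: dist_commute)
  qed
  show ?thesis
  proof (rule ccontr)
    assume "\<not> ?thesis"
    then have "\<exists>y\<in>S. h x < h y" if "x \<in> S" for x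
      using that by (meson not_le)
    then have "S \<subseteq> (\<Union>y\<in>S. {x \<in> \<Omega>. h x < h y})"
      using \<open>S \<subseteq> \<Omega>\<close> by blast
    then obtain T where T: "T \<subseteq> S" "finite T" "S \<subseteq> (\<Union>y\<in>T. {x \<in> \<Omega>. h x < h y})"
      using compactE_image[OF \<open>compact S\<close>, of S "\<lambda>y. {x \<in> \<Omega>. h x < h y}"] op by metis
    have "T \<noteq> {}"
      using T(3) \<open>S \<noteq> {}\<close> by auto
    then obtain m where m: "m \<in> T" "Max (h ` T) = h m"
      using obtains_MAX[OF T(2)] by blast
    then obtain y where "y \<in> T" "h m < h y"
      using T(1,3) by blast
    then show False
      using Max_ge[of "h ` T" "h y"] m(2) T(2) by simp
  qed
qed

lemma usc_on_diff_continuous_on: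
  assumes usc: "usc_on S u" and cont: "continuous_on S \<phi>"
  shows "usc_on S (\<lambda>x. u x - \<phi> x)"
  unfolding usc_on_def
proof (intro ballI allI impI)
  fix x a assume x: "x \<in> S" and a: "u x - \<phi> x < a"
  define b where "b = (a - (u x - \<phi> x)) / 2"
  have b: "0 < b"
    using a by (simp add: b_def)
  have "\<forall>\<^sub>F y in at x within S. u y < u x + b"
    using usc x b by (auto simp: usc_on_def)
  moreover have "\<forall>\<^sub>F y in at x within S. \<phi> x - b < \<phi> y"
    using cont x b by (intro order_tendstoD(1)[of _ "\<phi> x"]) (auto simp: continuous_on_def)
  ultimately show "\<forall>\<^sub>F y in at x within S. u y - \<phi> y < a"
    by eventually_elim (simp add: b_def field_simps)
qed

lemma C2_on_with_paraboloid:
  fixes y\<^sub>0 :: "real^'n"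
  shows "C2_on_with \<Omega> (\<lambda>y. A * ((y - y\<^sub>0) \<bullet> (y - y\<^sub>0))) (\<lambda>y. (2 * A) *\<^sub>R (y - y\<^sub>0))
           (\<lambda>_. (2 * A) *\<^sub>R mat 1)"
  unfolding C2_on_with_def gderiv_def
proof (intro conjI ballI)
  fix x :: "real^'n"
  show "((\<lambda>y. A * ((y - y\<^sub>0) \<bullet> (y - y\<^sub>0))) has_derivative (\<lambda>h. h \<bullet> (2 * A) *\<^sub>R (x - y\<^sub>0))) (at x)"
    by (auto intro!: derivative_eq_intros simp: inner_commute algebra_simps)
  show "((\<lambda>y. (2 * A) *\<^sub>R (y - y\<^sub>0)) has_derivative (\<lambda>h. ((2 * A) *\<^sub>R mat 1) *v h)) (at x)"
    by (auto intro!: derivative_eq_intros simp: scaleR_matrix_vector_assoc[symmetric])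
qed auto

text \<open>On the closed ball \<open>u\<close> varies by at most \<open>2 * w\<close>, so a
  paraboloid that rises by more than this from center to sphere forces the maximum of the difference
  into the open ball. There it is a local maximum, and the subsolution test applies.\<close>

lemma viscosity_subsolution_touching:
  fixes y\<^sub>0 :: "real^'n"
  assumes "open \<Omega>" and sub: "viscosity_subsolution \<Omega> F u"
    and "0 < r" and ball: "cball y\<^sub>0 r \<subseteq> \<Omega>"
    and w: "0 < w" "\<And>y. y \<in> cball y\<^sub>0 r \<Longrightarrow> \<bar>u y - M\<bar> \<le> w"
  obtains z where "z \<in> cball y\<^sub>0 r"
    and "u z + F (z, (8 * w / r\<^sup>2) *\<^sub>R (z - y\<^sub>0), (8 * w / r\<^sup>2) *\<^sub>R mat 1) \<le> 0"
proof -
  \<comment> \<open>With this opening the paraboloid has height \<open>A * r\<^sup>2 = 4 * w\<close>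
    on the sphere.\<close>
  define A where "A = 4 * w / r\<^sup>2"
  define \<phi> where "\<phi> y = A * ((y - y\<^sub>0) \<bullet> (y - y\<^sub>0))" for y
  have "usc_on \<Omega> u"
    using sub by (simp add: viscosity_subsolution_def)
  then have "usc_on \<Omega> (\<lambda>y. u y - \<phi> y)"
    unfolding \<phi>_def by (rule usc_on_diff_continuous_on) (intro continuous_intros)
  then obtain z where z: "z \<in> cball y\<^sub>0 r" "\<And>y. y \<in> cball y\<^sub>0 r \<Longrightarrow> u y - \<phi> y \<le> u z - \<phi> z"
    using usc_on_attains_sup[OF \<open>open \<Omega>\<close> _ compact_cball ball] \<open>0 < r\<close> by force
  have "z \<in> ball y\<^sub>0 r"
  proof (rule ccontr)
    assume "z \<notin> ball y\<^sub>0 r"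
    then have "norm (z - y\<^sub>0) = r"
      using z(1) by (simp add: dist_norm norm_minus_commute)
    then have "\<phi> z = 4 * w"
      using \<open>0 < r\<close> by (simp add: \<phi>_def A_def dot_square_norm)
    \<comment> \<open>On the sphere \<open>u z - \<phi> z\<close> is at most
      \<open>M - 3 * w\<close>, whereas at the center the difference is at least
      \<open>M - w\<close>.\<close>
    then show False
      using z(2)[of y\<^sub>0] w(1) w(2)[of y\<^sub>0] w(2)[OF z(1)] \<open>0 < r\<close> by (simp add: \<phi>_def)
  qed
  then have "\<forall>\<^sub>F y in at z within \<Omega>. y \<in> ball y\<^sub>0 r"
    by (intro eventually_at_in_open'[THEN filter_leD[OF at_le[OF subset_UNIV]]]) auto
  then have "\<forall>\<^sub>F y in at z within \<Omega>. u y - \<phi> y \<le> u z - \<phi> z"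
    by (rule eventually_mono) (use z(2) in auto)
  moreover have "C2_on_with \<Omega> \<phi> (\<lambda>y. (2 * A) *\<^sub>R (y - y\<^sub>0)) (\<lambda>_. (2 * A) *\<^sub>R mat 1)"
    unfolding \<phi>_def by (rule C2_on_with_paraboloid)
  ultimately have "u z + F (z, (2 * A) *\<^sub>R (z - y\<^sub>0), (2 * A) *\<^sub>R mat 1) \<le> 0"
    using sub z(1) ball unfolding viscosity_subsolution_def by blast
  moreover have "2 * A = 8 * w / r\<^sup>2"
    by (simp add: A_def)
  ultimately show ?thesis
    using z(1) that by simp
qed

section \<open>Limits of subsolutions at the boundary\<close>

text \<open>Phrased with a limit \<open>M\<close> of \<open>u\<close> and with eventual bounds on
  \<open>F\<close>, so that it serves subsolutions with a continuous envelope, continuous solutions,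
  and, after reflection, supersolutions.\<close>

lemma subsolution_boundary_limit_nonpos:
  fixes x\<^sub>0 :: "real^'n"
  assumes "open \<Omega>" and "interior_cone_property \<Omega>" and x0: "x\<^sub>0 \<in> frontier \<Omega>"
    and F: "\<And>\<omega> \<epsilon>. modulus_of_continuity \<omega> \<Longrightarrow> 0 < \<epsilon> \<Longrightarrow>
              \<forall>\<^sub>F \<delta> in at_right 0. \<forall>t\<in>jet_set {x\<in>\<Omega>. dist x x\<^sub>0 \<le> \<delta>} \<omega> \<delta>. - \<epsilon> \<le> F t"
    and sub: "viscosity_subsolution \<Omega> F u"
    and lim: "(u \<longlongrightarrow> M) (at x\<^sub>0 within \<Omega>)"
  shows "M \<le> 0"
proof -
  have "x\<^sub>0 \<notin> \<Omega>"
    using x0 \<open>open \<Omega>\<close> by (simp add: frontier_def interior_open)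
  obtain s\<^sub>0 where s0: "0 < s\<^sub>0" "\<And>s. 0 < s \<Longrightarrow> s < s\<^sub>0 \<Longrightarrow> \<exists>\<nu> c. c > 0 \<and>
      (\<forall>y\<in>closure \<Omega> \<inter> ball x\<^sub>0 s. \<forall>\<tau>. 0 < \<tau> \<and> \<tau> \<le> c \<longrightarrow> ball (y + \<tau> *\<^sub>R \<nu> y) (c * \<tau>) \<subseteq> \<Omega>)"
    using \<open>interior_cone_property \<Omega>\<close> x0 unfolding interior_cone_property_def by metis
  have "x\<^sub>0 \<in> closure \<Omega> \<inter> ball x\<^sub>0 (s\<^sub>0 / 2)"
    using x0 s0(1) by (simp add: frontier_def)
  \<comment> \<open>The interior condition is read at the boundary point \<open>x\<^sub>0\<close>
    itself; from here on \<open>\<nu>\<close> is the fixed vector attached to that point.\<close>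
  then obtain \<nu> c where c: "0 < c"
      "\<And>\<tau>. 0 < \<tau> \<Longrightarrow> \<tau> \<le> c \<Longrightarrow> ball (x\<^sub>0 + \<tau> *\<^sub>R \<nu>) (c * \<tau>) \<subseteq> \<Omega>"
    using s0(2)[of "s\<^sub>0 / 2"] s0(1) by (metis field_sum_of_halves half_gt_zero less_add_same_cancel1)
  have "\<forall>\<^sub>F y in at x\<^sub>0 within \<Omega>. dist (u y) M < 1"
    using tendstoD[OF lim zero_less_one] .
  then obtain R where "0 < R" and R': "\<forall>y\<in>\<Omega>. y \<noteq> x\<^sub>0 \<and> dist y x\<^sub>0 < R \<longrightarrow> dist (u y) M < 1"
    unfolding eventually_at by blast
  \<comment> \<open>Restricting to a ball where \<open>u\<close> is close to its limit supplies the
    boundedness required for a dominating modulus.\<close>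
  have R: "\<bar>u y - M\<bar> < 1" if "y \<in> \<Omega>" "dist y x\<^sub>0 < R" for y
    using R' that \<open>x\<^sub>0 \<notin> \<Omega>\<close> by (auto simp: dist_real_def)
  have "((\<lambda>y. u y - M) \<longlongrightarrow> 0) (at x\<^sub>0 within (\<Omega> \<inter> ball x\<^sub>0 R))"
    by (rule tendsto_within_subset[OF LIM_zero[OF lim]]) simp
  moreover have "bounded ((\<lambda>y. u y - M) ` (\<Omega> \<inter> ball x\<^sub>0 R))"
    unfolding bounded_iff using R by (intro exI[of _ 1]) (auto simp: dist_commute less_imp_le)
  ultimately obtain \<omega>\<^sub>0 where \<omega>\<^sub>0: "modulus_of_continuity \<omega>\<^sub>0"
      "\<And>y. y \<in> \<Omega> \<inter> ball x\<^sub>0 R \<Longrightarrow> \<bar>u y - M\<bar> \<le> \<omega>\<^sub>0 (dist y x\<^sub>0)"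
    using dominating_modulus_of_continuity[of "\<lambda>y. u y - M" x\<^sub>0 "\<Omega> \<inter> ball x\<^sub>0 R"] \<open>x\<^sub>0 \<notin> \<Omega>\<close> by blast
  \<comment> \<open>Adding the identity makes the modulus strictly positive on \<open>(0, \<infinity>)\<close>.\<close>
  define \<omega> where "\<omega> t = \<omega>\<^sub>0 t + t" for t
  \<comment> \<open>Every point of the ball of radius \<open>c * \<tau>\<close> about
    \<open>x\<^sub>0 + \<tau> *\<^sub>R \<nu>\<close> lies within \<open>C * \<tau>\<close> of
    \<open>x\<^sub>0\<close>; this fixes the relation \<open>\<delta> = C * \<tau>\<close> between
    the two scales.\<close>
  define C where "C = norm \<nu> + c"
  define N where "N = norm (mat 1 :: real^'n^'n)"
  \<comment> \<open>For \<open>r = c * \<delta> / (2 * C)\<close>, the bounds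
    \<open>8 * \<omega> \<delta> / r\<close> on the gradient and
    \<open>8 * \<omega> \<delta> * N / r\<^sup>2\<close> on the Hessian are the two summands times
    \<open>\<omega> \<delta> / \<delta>\<close> and
    \<open>\<omega> \<delta> / \<delta>\<^sup>2\<close>. Since the condition on \<open>F\<close>
    holds for every modulus, it can be applied to \<open>K * \<omega>\<close>, which absorbs both
    constants.\<close>
  define K where "K = 16 * C / c + 32 * C\<^sup>2 * N / c\<^sup>2"
  have "0 < C" "0 \<le> N"
    using c(1) by (auto simp: C_def N_def add_nonneg_pos)
  then have K: "0 \<le> K" "16 * C / c \<le> K" "32 * C\<^sup>2 * N / c\<^sup>2 \<le> K"
    using c(1) by (auto simp: K_def)
  have \<omega>: "modulus_of_continuity \<omega>" and K\<omega>: "modulus_of_continuity (\<lambda>t. K * \<omega> t)"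
    using \<omega>\<^sub>0(1) K(1) unfolding modulus_of_continuity_def \<omega>_def
    by (auto intro!: continuous_intros add_mono mult_left_mono simp: mono_on_def)
  \<comment> \<open>The bound \<open>\<delta> < R\<close> keeps the touching ball where the modulus
    controls \<open>u\<close>; the bound \<open>\<delta> < C * c\<close> ensures
    \<open>\<tau> \<le> c\<close>.\<close>
  have est: "M - \<omega> \<delta> \<le> \<epsilon>"
    if \<delta>: "0 < \<delta>" "\<delta> < R" "\<delta> < C * c"
      and F\<delta>: "\<forall>t\<in>jet_set {x\<in>\<Omega>. dist x x\<^sub>0 \<le> \<delta>} (\<lambda>t. K * \<omega> t) \<delta>. - \<epsilon> \<le> F t" for \<delta> \<epsilon>
  proof -
    define \<tau> where "\<tau> = \<delta> / C"
    \<comment> \<open>Half of the available radius, so that the closed ball still lies in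
      \<open>\<Omega>\<close>.\<close>
    define r where "r = c * \<tau> / 2"
    define y\<^sub>0 where "y\<^sub>0 = x\<^sub>0 + \<tau> *\<^sub>R \<nu>"
    have \<tau>: "0 < \<tau>" "\<tau> \<le> c" "\<delta> = C * \<tau>"
      using \<delta> \<open>0 < C\<close> by (auto simp: \<tau>_def field_simps)
    have r: "0 < r" "r < c * \<tau>"
      using \<tau> c(1) by (auto simp: r_def)
    have ball: "cball y\<^sub>0 r \<subseteq> \<Omega>"
      using c(2)[OF \<tau>(1,2)] r(2) by (force simp: y\<^sub>0_def)
    have near: "dist y x\<^sub>0 \<le> \<delta>" if "y \<in> cball y\<^sub>0 r" for y
    proof -
      have "dist y x\<^sub>0 \<le> dist y y\<^sub>0 + dist y\<^sub>0 x\<^sub>0"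
        by (rule dist_triangle)
      also have "\<dots> \<le> c * \<tau> + \<tau> * norm \<nu>"
        using that r(2) \<tau>(1) by (intro add_mono) (auto simp: y\<^sub>0_def dist_norm norm_minus_commute)
      finally show ?thesis
        by (simp add: \<tau>(3) C_def algebra_simps)
    qed
    have \<omega>pos: "0 < \<omega> \<delta>"
      using \<omega>\<^sub>0(1) \<delta>(1) by (auto simp: \<omega>_def modulus_of_continuity_def add_nonneg_pos)
    have osc: "\<bar>u y - M\<bar> \<le> \<omega> \<delta>" if y: "y \<in> cball y\<^sub>0 r" for y
    proof -
      have "\<bar>u y - M\<bar> \<le> \<omega>\<^sub>0 (dist y x\<^sub>0)"
        using y ball near[OF y] \<delta>(2) by (intro \<omega>\<^sub>0(2)) (auto simp: dist_commute)
      also have "\<dots> \<le> \<omega>\<^sub>0 \<delta>"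
        using \<omega>\<^sub>0(1) near[OF y] \<delta>(1) by (auto simp: modulus_of_continuity_def mono_on_def)
      finally show ?thesis
        using \<delta>(1) by (simp add: \<omega>_def)
    qed
    obtain z where z: "z \<in> cball y\<^sub>0 r"
      and visc: "u z + F (z, (8 * \<omega> \<delta> / r\<^sup>2) *\<^sub>R (z - y\<^sub>0), (8 * \<omega> \<delta> / r\<^sup>2) *\<^sub>R mat 1) \<le> 0"
      using viscosity_subsolution_touching[OF \<open>open \<Omega>\<close> sub r(1) ball \<omega>pos osc] by blast
    have "norm ((8 * \<omega> \<delta> / r\<^sup>2) *\<^sub>R (z - y\<^sub>0)) \<le> 8 * \<omega> \<delta> / r\<^sup>2 * r"
      unfolding norm_scaleR using z \<omega>pos by (intro mult_mono) (auto simp: dist_norm norm_minus_commute)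
    also have "\<dots> = 16 * C / c * (\<omega> \<delta> / \<delta>)"
      using r(1) \<tau> c(1) \<open>0 < C\<close> by (simp add: r_def \<tau>(3) field_simps power2_eq_square)
    also have "\<dots> \<le> K * (\<omega> \<delta> / \<delta>)"
      using K(2) \<omega>pos \<delta>(1) by (intro mult_right_mono) auto
    finally have p: "norm ((8 * \<omega> \<delta> / r\<^sup>2) *\<^sub>R (z - y\<^sub>0)) \<le> K * \<omega> \<delta> / \<delta>"
      by simp
    have "norm ((8 * \<omega> \<delta> / r\<^sup>2) *\<^sub>R (mat 1 :: real^'n^'n)) = 8 * \<omega> \<delta> / r\<^sup>2 * N"
      using \<omega>pos by (simp add: N_def)
    also have "\<dots> = 32 * C\<^sup>2 * N / c\<^sup>2 * (\<omega> \<delta> / \<delta>\<^sup>2)"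
      using r(1) \<tau> c(1) \<open>0 < C\<close> by (simp add: r_def \<tau>(3) field_simps power2_eq_square)
    also have "\<dots> \<le> K * (\<omega> \<delta> / \<delta>\<^sup>2)"
      using K(3) \<omega>pos by (intro mult_right_mono) auto
    finally have X: "norm ((8 * \<omega> \<delta> / r\<^sup>2) *\<^sub>R (mat 1 :: real^'n^'n)) \<le> K * \<omega> \<delta> / \<delta>\<^sup>2"
      by simp
    have "(8 * \<omega> \<delta> / r\<^sup>2) *\<^sub>R mat 1 \<in> (sym_matrices :: (real^'n^'n) set)"
      by (auto simp: sym_matrices_def transpose_def mat_def vec_eq_iff)
    then have "(z, (8 * \<omega> \<delta> / r\<^sup>2) *\<^sub>R (z - y\<^sub>0), (8 * \<omega> \<delta> / r\<^sup>2) *\<^sub>R mat 1)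
        \<in> jet_set {x\<in>\<Omega>. dist x x\<^sub>0 \<le> \<delta>} (\<lambda>t. K * \<omega> t) \<delta>"
      using p X z ball near[OF z] unfolding jet_set_def by blast
    then have "- \<epsilon> \<le> F (z, (8 * \<omega> \<delta> / r\<^sup>2) *\<^sub>R (z - y\<^sub>0), (8 * \<omega> \<delta> / r\<^sup>2) *\<^sub>R mat 1)"
      using F\<delta> by blast
    then show ?thesis
      using visc osc[OF z] by linarith
  qed
  \<comment> \<open>First \<open>\<delta>\<close> tends to 0 with \<open>\<epsilon>\<close> fixed,
    which removes \<open>\<omega> \<delta>\<close>; then \<open>\<epsilon>\<close> is
    arbitrary.\<close>
  have "M \<le> \<epsilon>" if "0 < \<epsilon>" for \<epsilon>
  proof -
    have "\<forall>\<^sub>F \<delta> in at_right 0. M - \<omega> \<delta> \<le> \<epsilon>"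
      using F[OF K\<omega> that] eventually_at_right_real[OF \<open>0 < R\<close>]
        eventually_at_right_real[OF mult_pos_pos[OF \<open>0 < C\<close> c(1)]]
      by eventually_elim (rule est; simp)
    moreover have "((\<lambda>\<delta>. M - \<omega> \<delta>) \<longlongrightarrow> M - 0) (at_right 0)"
      by (intro tendsto_intros modulus_of_continuity_tendsto \<omega>)
    ultimately show ?thesis
      using tendsto_upperbound[of "\<lambda>\<delta>. M - \<omega> \<delta>" M "at_right 0" \<epsilon>] by simp
  qed
  then show ?thesis
    by (rule field_le_epsilon[of M 0, simplified])
qed

section \<open>Reflection from subsolutions to supersolutions\<close>

lemma matrix_vector_mult_uminus_left:
  fixes A :: "real^'n^'m"
  shows "(- A) *v x = - (A *v x)"
  by (simp add: vec_eq_iff matrix_vector_mult_def sum_negf)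

lemma C2_on_with_uminus:
  "C2_on_with \<Omega> \<phi> g H \<Longrightarrow> C2_on_with \<Omega> (\<lambda>x. - \<phi> x) (\<lambda>x. - g x) (\<lambda>x. - H x)"
  unfolding C2_on_with_def gderiv_def
  using has_derivative_minus[of \<phi>] has_derivative_minus[of g]
  by (auto intro!: continuous_intros simp: matrix_vector_mult_uminus_left[abs_def])

lemma lsc_on_iff_usc_on_uminus: "lsc_on S u \<longleftrightarrow> usc_on S (\<lambda>x. - u x)"
proof -
  \<comment> \<open>Negating the bound variable matches the thresholds below \<open>u x\<close> with
    those above \<open>- u x\<close>.\<close>
  have "(\<forall>a. P a) \<longleftrightarrow> (\<forall>a. P (- a))" for P :: "real \<Rightarrow> bool"
    by (metis minus_minus)
  from this[of "\<lambda>a. a < u x \<longrightarrow> (\<forall>\<^sub>F y in at x within S. a < u y)" for x] show ?thesis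
    unfolding lsc_on_def usc_on_def by (simp add: minus_less_iff)
qed

text \<open>If \<open>\<phi>\<close> touches \<open>- u\<close> from above, then
  \<open>- \<phi>\<close> touches \<open>u\<close> from below, and its gradient and Hessian are
  those of \<open>\<phi>\<close> with the sign changed. This dictates the three signs in the
  reflected operator.\<close>

lemma viscosity_supersolution_uminus:
  assumes "viscosity_supersolution \<Omega> F u"
  shows "viscosity_subsolution \<Omega> (\<lambda>(x, p, X). - F (x, - p, - X)) (\<lambda>x. - u x)"
  unfolding viscosity_subsolution_def
proof (intro conjI ballI allI impI)
  show "locally_bounded_on \<Omega> (\<lambda>x. - u x)"
    using assms unfolding viscosity_supersolution_def locally_bounded_on_def bounded_iff by simp
  show "usc_on \<Omega> (\<lambda>x. - u x)"
    using assms by (simp add: viscosity_supersolution_def lsc_on_iff_usc_on_uminus)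
  fix z \<phi> g H
  assume z: "z \<in> \<Omega>" and C2: "C2_on_with \<Omega> \<phi> g H"
    and max: "\<forall>\<^sub>F y in at z within \<Omega>. - u y - \<phi> y \<le> - u z - \<phi> z"
  have "\<forall>\<^sub>F y in at z within \<Omega>. u z - (- \<phi> z) \<le> u y - (- \<phi> y)"
    using max by eventually_elim simp
  then have "0 \<le> u z + F (z, - g z, - H z)"
    using assms z C2_on_with_uminus[OF C2] unfolding viscosity_supersolution_def by blast
  then show "- u z + (case (z, g z, H z) of (x, p, X) \<Rightarrow> - F (x, - p, - X)) \<le> 0"
    by simp
qed

text \<open>The constraints on \<open>p\<close> and \<open>X\<close> are norm bounds and symmetry,
  all invariant under negation. Hence bounds on \<open>F\<close> over a jet set pass to the
  reflected operator over the same set.\<close>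

lemma jet_set_uminus:
  "(x, p, X) \<in> jet_set A \<omega> \<delta> \<Longrightarrow> (x, - p, - X) \<in> jet_set A \<omega> \<delta>"
  by (auto simp: jet_set_def sym_matrices_def transpose_def vec_eq_iff)

lemma supersolution_boundary_limit_nonneg:
  fixes x\<^sub>0 :: "real^'n"
  assumes "open \<Omega>" and "interior_cone_property \<Omega>" and "x\<^sub>0 \<in> frontier \<Omega>"
    and F: "\<And>\<omega> \<epsilon>. modulus_of_continuity \<omega> \<Longrightarrow> 0 < \<epsilon> \<Longrightarrow>
              \<forall>\<^sub>F \<delta> in at_right 0. \<forall>t\<in>jet_set {x\<in>\<Omega>. dist x x\<^sub>0 \<le> \<delta>} \<omega> \<delta>. F t \<le> \<epsilon>"
    and super: "viscosity_supersolution \<Omega> F u"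
    and lim: "(u \<longlongrightarrow> M) (at x\<^sub>0 within \<Omega>)"
  shows "0 \<le> M"
proof -
  have "- M \<le> 0"
  proof (rule subsolution_boundary_limit_nonpos[OF assms(1-3) _
        viscosity_supersolution_uminus[OF super] tendsto_minus[OF lim]])
    fix \<omega> :: "real \<Rightarrow> real" and \<epsilon> :: real
    assume "modulus_of_continuity \<omega>" "0 < \<epsilon>"
    from F[OF this] show "\<forall>\<^sub>F \<delta> in at_right 0. \<forall>t\<in>jet_set {x\<in>\<Omega>. dist x x\<^sub>0 \<le> \<delta>} \<omega> \<delta>.
        - \<epsilon> \<le> (case t of (x, p, X) \<Rightarrow> - F (x, - p, - X))"
      by eventually_elim (auto dest: jet_set_uminus)
  qed
  then show ?thesis
    by simp
qed

section \<open>Semicontinuous envelopes in the interior and at the boundary\<close>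

text \<open>The point \<open>x\<close> itself belongs to each set, so the supremum is never below
  \<open>u x\<close>; upper semicontinuity bounds it from above on small balls.\<close>

lemma usc_on_SUP_tendsto:
  fixes u :: "'a::metric_space \<Rightarrow> real"
  assumes bdd: "bdd_above (u ` \<Omega>)" and usc: "usc_on \<Omega> u" and x: "x \<in> \<Omega>"
  shows "((\<lambda>\<delta>. SUP y\<in>{y\<in>\<Omega>. dist y x \<le> \<delta>}. u y) \<longlongrightarrow> u x) (at_right 0)"
proof (rule order_tendstoI)
  fix a assume a: "a < u x"
  show "\<forall>\<^sub>F \<delta> in at_right 0. a < (SUP y\<in>{y\<in>\<Omega>. dist y x \<le> \<delta>}. u y)"
    using eventually_at_right_less
  proof eventually_elim
    case (elim \<delta>)
    have "u x \<le> (SUP y\<in>{y\<in>\<Omega>. dist y x \<le> \<delta>}. u y)"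
      by (rule cSUP_upper) (use x elim in \<open>auto intro: bdd_above_mono[OF bdd]\<close>)
    then show ?case
      using a by simp
  qed
next
  fix a assume a: "u x < a"
  \<comment> \<open>The intermediate value makes up for the loss of strictness when a pointwise
    bound passes to the supremum.\<close>
  then obtain b where b: "u x < b" "b < a"
    using dense by blast
  have "\<forall>\<^sub>F y in at x within \<Omega>. u y < b"
    using usc x b(1) by (simp add: usc_on_def)
  then obtain d where d: "0 < d" "\<And>y. y \<in> \<Omega> \<Longrightarrow> y \<noteq> x \<Longrightarrow> dist y x < d \<Longrightarrow> u y < b"
    unfolding eventually_at by blast
  show "\<forall>\<^sub>F \<delta> in at_right 0. (SUP y\<in>{y\<in>\<Omega>. dist y x \<le> \<delta>}. u y) < a"
    using eventually_at_right_real[OF d(1)]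
  proof eventually_elim
    case (elim \<delta>)
    have "(SUP y\<in>{y\<in>\<Omega>. dist y x \<le> \<delta>}. u y) \<le> b"
    proof (rule cSUP_least)
      show "{y \<in> \<Omega>. dist y x \<le> \<delta>} \<noteq> {}"
        using x elim by force
      show "u y \<le> b" if "y \<in> {y \<in> \<Omega>. dist y x \<le> \<delta>}" for y
        using that d(2)[of y] b(1) elim by (cases "y = x") auto
    qed
    then show ?case
      using b(2) by simp
  qed
qed

text \<open>Lets continuity of the envelope at a boundary point be turned into a limit of
  \<open>u\<close> along \<open>\<Omega>\<close>.\<close>

lemma upper_envelope_eq:
  assumes "bdd_above (u ` \<Omega>)" "usc_on \<Omega> u" "x \<in> \<Omega>"
  shows "upper_envelope \<Omega> u x = u x"
  unfolding upper_envelope_def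
  by (rule tendsto_Lim[OF trivial_limit_at_right_real usc_on_SUP_tendsto[OF assms]])

lemma lower_envelope_eq:
  assumes "bdd_below (u ` \<Omega>)" "lsc_on \<Omega> u" "x \<in> \<Omega>"
  shows "lower_envelope \<Omega> u x = u x"
proof -
  have "bdd_above ((\<lambda>y. - u y) ` \<Omega>)"
    using assms(1) bdd_above_uminus[of "u ` \<Omega>"] by (simp add: image_image)
  then have "((\<lambda>\<delta>. SUP y\<in>{y\<in>\<Omega>. dist y x \<le> \<delta>}. - u y) \<longlongrightarrow> - u x) (at_right 0)"
    using assms(2,3) by (intro usc_on_SUP_tendsto) (auto simp: lsc_on_iff_usc_on_uminus)
  \<comment> \<open>On the reals, \<open>Inf\<close> is by definition the negative of
    \<open>Sup\<close> of the negated set.\<close>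
  from tendsto_minus[OF this]
  have "((\<lambda>\<delta>. INF y\<in>{y\<in>\<Omega>. dist y x \<le> \<delta>}. u y) \<longlongrightarrow> u x) (at_right 0)"
    by (simp add: Inf_real_def image_image)
  then show ?thesis
    unfolding lower_envelope_def by (rule tendsto_Lim[OF trivial_limit_at_right_real])
qed

lemma continuous_closure_tendsto:
  assumes "continuous (at x within closure S) f" and "\<And>y. y \<in> S \<Longrightarrow> f y = g y"
  shows "(g \<longlongrightarrow> f x) (at x within S)"
proof -
  have "(f \<longlongrightarrow> f x) (at x within S)"
    using assms(1) unfolding continuous_within
    by (rule tendsto_within_subset) (rule closure_subset)
  then show ?thesis
    by (rule Lim_transform_eventually) (auto simp: eventually_at_filter assms(2))
qed

section \<open>From limits of infima and suprema to eventual bounds on the operator\<close>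

theorem proposition2p3:
  fixes \<Omega> :: "(real^'n) set"
    and F :: "(real^'n) \<times> (real^'n) \<times> (real^'n^'n) \<Rightarrow> real"
    and x\<^sub>0 :: "real^'n"
  assumes "open \<Omega>" and "connected \<Omega>"
    and "interior_cone_property \<Omega>"
    and "continuous_on (\<Omega> \<times> UNIV \<times> sym_matrices) F"
    and "\<And>x p X Y. x \<in> \<Omega> \<Longrightarrow> X \<in> sym_matrices \<Longrightarrow> Y \<in> sym_matrices \<Longrightarrow> loewner_le Y X
           \<Longrightarrow> F (x, p, X) \<le> F (x, p, Y)"
    and "x\<^sub>0 \<in> frontier \<Omega>"
  shows
    "((\<forall>\<omega>. modulus_of_continuity \<omega> \<longrightarrow>
         (\<exists>L\<ge>0. ((\<lambda>\<delta>. INF t\<in>jet_set {x\<in>\<Omega>. dist x x\<^sub>0 \<le> \<delta>} \<omega> \<delta>. ereal (F t)) \<longlongrightarrow> L) (at_right 0)))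
      \<longrightarrow> (\<forall>u. bounded (u ` \<Omega>) \<and> viscosity_subsolution \<Omega> F u
               \<and> continuous (at x\<^sub>0 within closure \<Omega>) (upper_envelope \<Omega> u)
             \<longrightarrow> upper_envelope \<Omega> u x\<^sub>0 \<le> 0))
     \<and>
     ((\<forall>\<omega>. modulus_of_continuity \<omega> \<longrightarrow>
         (\<exists>L\<le>0. ((\<lambda>\<delta>. SUP t\<in>jet_set {x\<in>\<Omega>. dist x x\<^sub>0 \<le> \<delta>} \<omega> \<delta>. ereal (F t)) \<longlongrightarrow> L) (at_right 0)))
      \<longrightarrow> (\<forall>u. bounded (u ` \<Omega>) \<and> viscosity_supersolution \<Omega> F u
               \<and> continuous (at x\<^sub>0 within closure \<Omega>) (lower_envelope \<Omega> u)
             \<longrightarrow> 0 \<le> lower_envelope \<Omega> u x\<^sub>0))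
     \<and>
     ((\<forall>\<omega>. modulus_of_continuity \<omega> \<longrightarrow>
         ((\<lambda>\<delta>. SUP t\<in>jet_set {x\<in>\<Omega>. infdist x (frontier \<Omega>) \<le> \<delta>} \<omega> \<delta>. ereal \<bar>F t\<bar>) \<longlongrightarrow> 0)
           (at_right 0))
      \<longrightarrow> (\<forall>u. viscosity_solution \<Omega> F u \<and> continuous_on (insert x\<^sub>0 \<Omega>) u \<longrightarrow> u x\<^sub>0 = 0))"
proof (intro conjI impI allI)
  fix u
  assume lim: "\<forall>\<omega>. modulus_of_continuity \<omega> \<longrightarrow>
      (\<exists>L\<ge>0. ((\<lambda>\<delta>. INF t\<in>jet_set {x\<in>\<Omega>. dist x x\<^sub>0 \<le> \<delta>} \<omega> \<delta>. ereal (F t)) \<longlongrightarrow> L) (at_right 0))"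
    and u: "bounded (u ` \<Omega>) \<and> viscosity_subsolution \<Omega> F u
      \<and> continuous (at x\<^sub>0 within closure \<Omega>) (upper_envelope \<Omega> u)"
  show "upper_envelope \<Omega> u x\<^sub>0 \<le> 0"
  proof (rule subsolution_boundary_limit_nonpos[OF assms(1,3,6)])
    fix \<omega> :: "real \<Rightarrow> real" and \<epsilon> :: real
    assume "modulus_of_continuity \<omega>" and \<epsilon>: "0 < \<epsilon>"
    then obtain L where L: "0 \<le> L"
        "((\<lambda>\<delta>. INF t\<in>jet_set {x\<in>\<Omega>. dist x x\<^sub>0 \<le> \<delta>} \<omega> \<delta>. ereal (F t)) \<longlongrightarrow> L) (at_right 0)"
      using lim by blast
    \<comment> \<open>The infimum lives in the extended reals, where it may be infinite for some
      \<open>\<delta>\<close>; a limit above \<open>- \<epsilon>\<close> still gives a real lower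
      bound on \<open>F\<close> for all small \<open>\<delta>\<close>.\<close>
    have "ereal (- \<epsilon>) < L"
      by (rule less_le_trans[OF _ L(1)]) (use \<epsilon> in simp)
    from order_tendstoD(1)[OF L(2) this]
    show "\<forall>\<^sub>F \<delta> in at_right 0. \<forall>t\<in>jet_set {x\<in>\<Omega>. dist x x\<^sub>0 \<le> \<delta>} \<omega> \<delta>. - \<epsilon> \<le> F t"
    proof eventually_elim
      case (elim \<delta>)
      show ?case
      proof
        fix t assume "t \<in> jet_set {x\<in>\<Omega>. dist x x\<^sub>0 \<le> \<delta>} \<omega> \<delta>"
        from less_INF_D[OF elim this] show "- \<epsilon> \<le> F t"
          by simp
      qed
    qed
  next
    show "viscosity_subsolution \<Omega> F u"
      using u by simp
    then show "(u \<longlongrightarrow> upper_envelope \<Omega> u x\<^sub>0) (at x\<^sub>0 within \<Omega>)"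
      using u by (intro continuous_closure_tendsto upper_envelope_eq)
        (auto simp: viscosity_subsolution_def intro: bounded_imp_bdd_above)
  qed
next
  fix u
  assume lim: "\<forall>\<omega>. modulus_of_continuity \<omega> \<longrightarrow>
      (\<exists>L\<le>0. ((\<lambda>\<delta>. SUP t\<in>jet_set {x\<in>\<Omega>. dist x x\<^sub>0 \<le> \<delta>} \<omega> \<delta>. ereal (F t)) \<longlongrightarrow> L) (at_right 0))"
    and u: "bounded (u ` \<Omega>) \<and> viscosity_supersolution \<Omega> F u
      \<and> continuous (at x\<^sub>0 within closure \<Omega>) (lower_envelope \<Omega> u)"
  show "0 \<le> lower_envelope \<Omega> u x\<^sub>0"
  proof (rule supersolution_boundary_limit_nonneg[OF assms(1,3,6)])
    fix \<omega> :: "real \<Rightarrow> real" and \<epsilon> :: real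
    assume "modulus_of_continuity \<omega>" and \<epsilon>: "0 < \<epsilon>"
    then obtain L where L: "L \<le> 0"
        "((\<lambda>\<delta>. SUP t\<in>jet_set {x\<in>\<Omega>. dist x x\<^sub>0 \<le> \<delta>} \<omega> \<delta>. ereal (F t)) \<longlongrightarrow> L) (at_right 0)"
      using lim by blast
    have "L < ereal \<epsilon>"
      by (rule le_less_trans[OF L(1)]) (use \<epsilon> in simp)
    from order_tendstoD(2)[OF L(2) this]
    show "\<forall>\<^sub>F \<delta> in at_right 0. \<forall>t\<in>jet_set {x\<in>\<Omega>. dist x x\<^sub>0 \<le> \<delta>} \<omega> \<delta>. F t \<le> \<epsilon>"
    proof eventually_elim
      case (elim \<delta>)
      show ?case
      proof
        fix t assume "t \<in> jet_set {x\<in>\<Omega>. dist x x\<^sub>0 \<le> \<delta>} \<omega> \<delta>"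
        from SUP_lessD[OF elim this] show "F t \<le> \<epsilon>"
          by simp
      qed
    qed
  next
    show "viscosity_supersolution \<Omega> F u"
      using u by simp
    then show "(u \<longlongrightarrow> lower_envelope \<Omega> u x\<^sub>0) (at x\<^sub>0 within \<Omega>)"
      using u by (intro continuous_closure_tendsto lower_envelope_eq)
        (auto simp: viscosity_supersolution_def intro: bounded_imp_bdd_below)
  qed
next
  fix u
  assume lim: "\<forall>\<omega>. modulus_of_continuity \<omega> \<longrightarrow>
      ((\<lambda>\<delta>. SUP t\<in>jet_set {x\<in>\<Omega>. infdist x (frontier \<Omega>) \<le> \<delta>} \<omega> \<delta>. ereal \<bar>F t\<bar>) \<longlongrightarrow> 0)
        (at_right 0)"
    and u: "viscosity_solution \<Omega> F u \<and> continuous_on (insert x\<^sub>0 \<Omega>) u"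
  have F: "\<forall>\<^sub>F \<delta> in at_right 0. \<forall>t\<in>jet_set {x\<in>\<Omega>. dist x x\<^sub>0 \<le> \<delta>} \<omega> \<delta>. \<bar>F t\<bar> \<le> \<epsilon>"
    if "modulus_of_continuity \<omega>" "0 < \<epsilon>" for \<omega> \<epsilon>
  proof -
    \<comment> \<open>The distance to the boundary is at most the distance to
      \<open>x\<^sub>0\<close>, so a bound on the strip along the boundary includes one near
      \<open>x\<^sub>0\<close>. The bound on \<open>\<bar>F t\<bar>\<close> then yields both
      one-sided conditions.\<close>
    have sub: "jet_set {x\<in>\<Omega>. dist x x\<^sub>0 \<le> \<delta>} \<omega> \<delta>
        \<subseteq> jet_set {x\<in>\<Omega>. infdist x (frontier \<Omega>) \<le> \<delta>} \<omega> \<delta>" for \<delta>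
      using infdist_le[OF assms(6)] unfolding jet_set_def by (blast intro: order_trans)
    have "\<forall>\<^sub>F \<delta> in at_right 0.
        (SUP t\<in>jet_set {x\<in>\<Omega>. infdist x (frontier \<Omega>) \<le> \<delta>} \<omega> \<delta>. ereal \<bar>F t\<bar>) < ereal \<epsilon>"
      using lim that by (intro order_tendstoD(2)[of _ 0]) auto
    then show ?thesis
    proof eventually_elim
      case (elim \<delta>)
      show ?case
      proof
        fix t assume "t \<in> jet_set {x\<in>\<Omega>. dist x x\<^sub>0 \<le> \<delta>} \<omega> \<delta>"
        with sub have "t \<in> jet_set {x\<in>\<Omega>. infdist x (frontier \<Omega>) \<le> \<delta>} \<omega> \<delta>"
          by blast
        from SUP_lessD[OF elim this] show "\<bar>F t\<bar> \<le> \<epsilon>"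
          by simp
      qed
    qed
  qed
  \<comment> \<open>Here \<open>u x\<^sub>0\<close> is itself the limit required by the two boundary
    lemmas. These localize near \<open>x\<^sub>0\<close>, so \<open>u\<close> may be unbounded
    elsewhere.\<close>
  have cont: "(u \<longlongrightarrow> u x\<^sub>0) (at x\<^sub>0 within \<Omega>)"
    using u by (auto simp: continuous_on_def intro: tendsto_within_subset)
  have "u x\<^sub>0 \<le> 0"
  proof (rule subsolution_boundary_limit_nonpos[OF assms(1,3,6) _ _ cont])
    show "\<forall>\<^sub>F \<delta> in at_right 0. \<forall>t\<in>jet_set {x\<in>\<Omega>. dist x x\<^sub>0 \<le> \<delta>} \<omega> \<delta>. - \<epsilon> \<le> F t"
      if "modulus_of_continuity \<omega>" "0 < \<epsilon>" for \<omega> \<epsilon>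
      using F[OF that] by eventually_elim (force simp: abs_le_iff)
  qed (use u in \<open>simp add: viscosity_solution_def\<close>)
  moreover have "0 \<le> u x\<^sub>0"
  proof (rule supersolution_boundary_limit_nonneg[OF assms(1,3,6) _ _ cont])
    show "\<forall>\<^sub>F \<delta> in at_right 0. \<forall>t\<in>jet_set {x\<in>\<Omega>. dist x x\<^sub>0 \<le> \<delta>} \<omega> \<delta>. F t \<le> \<epsilon>"
      if "modulus_of_continuity \<omega>" "0 < \<epsilon>" for \<omega> \<epsilon>
      using F[OF that] by eventually_elim (force simp: abs_le_iff)
  qed (use u in \<open>simp add: viscosity_solution_def\<close>)
  ultimately show "u x\<^sub>0 = 0"
    by simp
qed

end
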